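(* Let $\{\phi_i\}_{i=1}^M\subset\mathbb{H}^N$ be unit norm vectors and let $\phi_{M+1}\in\mathbb{H}^N$ be an additional unit norm vector. Assume that $\{\phi_i\phi_i^*\}_{i=1}^M$ is linearly independent and that $M+1\le\dim\mathrm{sym}(\mathbb{H}^{N\times N})$. Let $G_{op}$ be the Gram matrix of $\{\phi_i\phi_i^*\}_{i=1}^M$, with orthonormal eigenvectors $\{e_i'\}_{i=1}^M$ and associated eigenvalues $\{\lambda_i'\}_{i=1}^M$. Let $T$ be the analysis operator of $\{\phi_i\}_{i=1}^M$, so that $T\phi_{M+1}=(\langle\phi_{M+1},\phi_1\rangle,\ldots,\langle\phi_{M+1},\phi_M\rangle)^T$. Consider the function $$f(x_1,\ldots,x_M)=\sum_{i=1}^M\frac{|x_i|^2}{\lambda_i'},$$ and let $y_1e_1'+\cdots+y_Me_M'=T\phi_{M+1}\circ\overline{T\phi_{M+1}}$ be the representation of $T\phi_{M+1}\circ\overline{T\phi_{M+1}}$ in the basis $\{e_1',\ldots,e_M'\}$. Then $f(y_1,\ldots,y_M)=1$ if and only if $\{\phi_i\phi_i^*\}_{i=1}^{M+1}$ is a dependent set.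
   Context: $\mathbb{H}$ denotes $\mathbb{R}$ or $\mathbb{C}$, with $\langle\phi,\psi\rangle=\sum_i\phi(i)\overline{\psi(i)}$. $\mathrm{sym}(\mathbb{H}^{N\times N})$ is the real vector space of self-adjoint $N\times N$ matrices over $\mathbb{H}$ (dimension $N(N+1)/2$ for $\mathbb{R}$, $N^2$ for $\mathbb{C}$), with the Frobenius inner product $\langle S,T\rangle_F=\mathrm{Tr}(ST^* )$, so $G_{op}=[|\langle\phi_i,\phi_j\rangle|^2]_{i,j=1}^M$. For $v\in\mathbb{H}^M$, $v\circ\overline v$ is the entrywise (Hadamard) product of $v$ with its complex conjugate. Dependence is understood as linear dependence of the indexed family. *)

theory Defs
  imports "HOL-Analysis.Analysis" "Jordan_Normal_Form.Conjugate"
begin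

(* The scalar field H, which is R or C. These axioms allow nothing else: by the
   Gelfand-Mazur theorem a real normed field is isometrically isomorphic to R or C,
   and the last axiom forces conjugate to be the usual conjugation. *)
class real_or_complex = real_normed_field + conjugatable_field +
  assumes mult_conjugate: "x * conjugate x = (norm x)\<^sup>2 *\<^sub>R 1"

instance real :: real_or_complex
  by standard (simp add: power2_eq_square)

instance complex :: real_or_complex
  by standard (simp only: conjugate_complex_def scaleR_conv_of_real complex_norm_square mult_1_right)

(* Conjugate-linear in the second argument. *)
definition hinner :: "'h::real_or_complex ^ 'n \<Rightarrow> 'h ^ 'n \<Rightarrow> 'h" where
  "hinner v w = (\<Sum>i\<in>UNIV. v $ i * conjugate (w $ i))"

definition conj_transpose :: "'h::real_or_complex ^ 'n ^ 'm \<Rightarrow> 'h ^ 'm ^ 'n" where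
  "conj_transpose A = (\<chi> i j. conjugate (A $ j $ i))"

definition sym_mats :: "('h::real_or_complex ^ 'n ^ 'n) set" where
  "sym_mats = {A. conj_transpose A = A}"

definition frobenius :: "'h::real_or_complex ^ 'n ^ 'n \<Rightarrow> 'h ^ 'n ^ 'n \<Rightarrow> 'h" where
  "frobenius S T = trace (S ** conj_transpose T)"

(* The rank-one matrix v v*. *)
definition outer :: "'h::real_or_complex ^ 'n \<Rightarrow> 'h ^ 'n ^ 'n" where
  "outer v = (\<chi> i j. v $ i * conjugate (v $ j))"

definition gram_op :: "('m \<Rightarrow> 'h::real_or_complex ^ 'n) \<Rightarrow> 'h ^ 'm ^ 'm" where
  "gram_op \<phi> = (\<chi> i j. frobenius (outer (\<phi> i)) (outer (\<phi> j)))"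

definition analysis_op :: "('m \<Rightarrow> 'h::real_or_complex ^ 'n) \<Rightarrow> 'h ^ 'n \<Rightarrow> 'h ^ 'm" where
  "analysis_op \<phi> v = (\<chi> i. hinner v (\<phi> i))"

definition conj_vec :: "'h::real_or_complex ^ 'm \<Rightarrow> 'h ^ 'm" where
  "conj_vec v = (\<chi> i. conjugate (v $ i))"

definition hadamard :: "'h::real_or_complex ^ 'm \<Rightarrow> 'h ^ 'm \<Rightarrow> 'h ^ 'm" where
  "hadamard v w = (\<chi> i. v $ i * w $ i)"

(* Dependence of an indexed family over the reals, the scalars of the space of self-adjoint
   matrices; unlike dependent (range A), it counts repeated members. *)
definition dependent_family :: "('i::finite \<Rightarrow> 'v::real_vector) \<Rightarrow> bool" where
  "dependent_family A \<longleftrightarrow>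
    (\<exists>c :: 'i \<Rightarrow> real. (\<exists>i. c i \<noteq> 0) \<and> (\<Sum>i\<in>UNIV. c i *\<^sub>R A i) = 0)"

end

theory Submission
  imports Defs
begin

text \<open>
  Write \<open>A i\<close> for \<open>outer (\<phi> i)\<close>, \<open>B\<close> for \<open>outer \<phi>_new\<close>, \<open>G\<close> for the Gram matrix of the \<open>A i\<close>
  and \<open>b\<close> for the vector \<open>T \<phi>_new \<circ> conj (T \<phi>_new)\<close>. Since the Frobenius product of two
  rank-one matrices is the squared modulus of the inner product of the vectors, \<open>b\<close> lists the
  Frobenius products of \<open>B\<close> with the \<open>A i\<close>, and \<open>B\<close> has norm 1. The Gram matrix is real and, by
  independence, invertible, so \<open>B\<close> has a projection \<open>\<Sum>i. c i *\<^sub>R A i\<close> on the real span of the \<open>A i\<close>,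
  with \<open>G c = b\<close>. The residual has squared norm \<open>1 - \<Sum>i. c i * b i\<close>; the enlarged family is
  dependent exactly when the residual vanishes, that is, when the squared norm
  \<open>\<Sum>i. c i * b i\<close> of the projection is 1 (lemma \<open>dependent_extension_iff\<close>).

  What remains is to recognise this number as \<open>f y\<close>. It is the value at \<open>b\<close> of the quadratic form
  of the inverse of \<open>G\<close>, and in an orthonormal eigenbasis of \<open>G\<close> that form is
  \<open>\<Sum>i. \<bar>y i\<bar>\<^sup>2 / \<mu> i\<close> (lemma \<open>quadratic_form_in_eigenbasis\<close>).
\<close>

section \<open>The scalar field and its inner product\<close>

text \<open>A nonzero real \<open>r\<close> satisfies \<open>r * conjugate r = r\<^sup>2\<close>, and \<open>r\<close> can be cancelled.\<close>

lemma conjugate_of_real [simp]: "conjugate (of_real r :: 'h::real_or_complex) = of_real r"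
proof (cases "r = 0")
  case False
  have "of_real r * conjugate (of_real r :: 'h) = of_real r * of_real r"
    using mult_conjugate[of "of_real r :: 'h"]
    by (simp add: scaleR_conv_of_real power2_eq_square flip: of_real_mult)
  with False show ?thesis by simp
qed simp

lemma conjugate_scaleR [simp]:
  "conjugate (r *\<^sub>R x) = r *\<^sub>R conjugate (x :: 'h::real_or_complex)"
  by (simp add: scaleR_conv_of_real conjugate_dist_mul)

lemma conjugate_diff: "conjugate (x - y) = conjugate x - conjugate (y :: 'h::conjugatable_ring)"
  using conjugate_dist_add[of x "- y"] by (simp add: conjugate_neg)

lemma mult_conjugate_of_real:
  "x * conjugate x = of_real ((norm (x :: 'h::real_or_complex))\<^sup>2)"
  by (simp add: mult_conjugate scaleR_conv_of_real)

lemma conjugate_hinner: "conjugate (hinner v w) = hinner w v"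
  by (simp add: hinner_def sum_conjugate conjugate_dist_mul mult.commute)

lemma hinner_self: "hinner v v = of_real ((norm v)\<^sup>2)"
proof -
  have "(norm v)\<^sup>2 = (\<Sum>i\<in>UNIV. (norm (v $ i))\<^sup>2)"
    by (simp add: norm_vec_def L2_set_def sum_nonneg)
  then show ?thesis by (simp add: hinner_def mult_conjugate_of_real)
qed

lemma hinner_sum_left:
  "hinner (\<Sum>i\<in>UNIV. y i *s e i) w = (\<Sum>i\<in>UNIV. y i * hinner (e i) w)"
  unfolding hinner_def
  by (simp add: sum_distrib_left sum_distrib_right mult.assoc)
    (rule sum.swap)

lemma hinner_scale_right: "hinner v (a *s w) = conjugate a * hinner v w"
  by (simp add: hinner_def conjugate_dist_mul sum_distrib_left algebra_simps)

lemma hinner_adjoint: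
  assumes "conj_transpose A = A"
  shows "hinner (A *v v) w = hinner v (A *v w)"
proof -
  have A: "conjugate (A $ i $ j) = A $ j $ i" for i j
    using assms by (auto simp: conj_transpose_def vec_eq_iff)
  have "hinner (A *v v) w = (\<Sum>i\<in>UNIV. \<Sum>j\<in>UNIV. A $ i $ j * v $ j * conjugate (w $ i))"
    by (simp add: hinner_def matrix_vector_mult_def sum_distrib_right)
  also have "\<dots> = (\<Sum>j\<in>UNIV. \<Sum>i\<in>UNIV. A $ i $ j * v $ j * conjugate (w $ i))"
    by (rule sum.swap)
  also have "\<dots> = hinner v (A *v w)"
    by (simp add: hinner_def matrix_vector_mult_def sum_conjugate conjugate_dist_mul A
        sum_distrib_left algebra_simps)
  finally show ?thesis .
qed

section \<open>The Frobenius product\<close>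

lemma frobenius_altdef:
  "frobenius S T = (\<Sum>i\<in>UNIV. \<Sum>j\<in>UNIV. S $ i $ j * conjugate (T $ i $ j))"
  by (simp add: frobenius_def trace_def matrix_matrix_mult_def conj_transpose_def)

lemma conjugate_frobenius: "conjugate (frobenius S T) = frobenius T S"
  by (simp add: frobenius_altdef sum_conjugate conjugate_dist_mul mult.commute)

lemma frobenius_diff_left: "frobenius (S - S') T = frobenius S T - frobenius S' T"
  by (simp add: frobenius_altdef left_diff_distrib sum_subtractf)

lemma frobenius_zero_left [simp]: "frobenius 0 T = 0"
  by (simp add: frobenius_altdef)

lemma frobenius_add_left: "frobenius (S + S') T = frobenius S T + frobenius S' T"
  by (simp add: frobenius_altdef distrib_right sum.distrib)

lemma frobenius_scaleR_left: "frobenius (r *\<^sub>R S) T = r *\<^sub>R frobenius S T"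
  by (simp add: frobenius_altdef scaleR_sum_right)

lemma frobenius_sum_left:
  "frobenius (\<Sum>i\<in>I. c i *\<^sub>R A i) T = (\<Sum>i\<in>I. c i *\<^sub>R frobenius (A i) T)"
  by (induction I rule: infinite_finite_induct)
    (simp_all add: frobenius_add_left frobenius_scaleR_left)

lemma frobenius_diff_right: "frobenius S (T - T') = frobenius S T - frobenius S T'"
  by (simp add: frobenius_altdef conjugate_diff right_diff_distrib sum_subtractf)

lemma frobenius_sum_right:
  "frobenius S (\<Sum>i\<in>I. c i *\<^sub>R A i) = (\<Sum>i\<in>I. c i *\<^sub>R frobenius S (A i))"
proof -
  have "frobenius S (\<Sum>i\<in>I. c i *\<^sub>R A i)
      = conjugate (\<Sum>i\<in>I. c i *\<^sub>R frobenius (A i) S)"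
    by (simp flip: frobenius_sum_left add: conjugate_frobenius)
  also have "\<dots> = (\<Sum>i\<in>I. c i *\<^sub>R frobenius S (A i))"
    by (cases "finite I") (simp_all add: sum_conjugate conjugate_frobenius)
  finally show ?thesis .
qed

lemma frobenius_self_eq_0_iff: "frobenius S S = 0 \<longleftrightarrow> S = 0"
proof
  assume "frobenius S S = 0"
  then have "of_real (\<Sum>i\<in>UNIV. \<Sum>j\<in>UNIV. (norm (S $ i $ j))\<^sup>2) = (0 :: 'a)"
    by (simp add: frobenius_altdef mult_conjugate_of_real)
  then have "(\<Sum>i\<in>UNIV. \<Sum>j\<in>UNIV. (norm (S $ i $ j))\<^sup>2) = 0"
    by (simp only: of_real_eq_0_iff)
  then show "S = 0"
    by (simp add: sum_nonneg_eq_0_iff sum_nonneg vec_eq_iff)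
qed simp

lemma frobenius_outer:
  "frobenius (outer v) (outer w) = of_real ((norm (hinner v w))\<^sup>2)"
proof -
  have "frobenius (outer v) (outer w)
      = (\<Sum>i\<in>UNIV. \<Sum>j\<in>UNIV. (v $ i * conjugate (w $ i)) * (conjugate (v $ j) * w $ j))"
    by (simp add: frobenius_altdef outer_def conjugate_dist_mul ac_simps)
  also have "\<dots> = hinner v w * conjugate (hinner v w)"
    by (simp add: hinner_def sum_conjugate conjugate_dist_mul sum_product)
  finally show ?thesis by (simp add: mult_conjugate_of_real)
qed

section \<open>Dependence and orthogonal projection\<close>

text \<open>A combination of the \<open>A i\<close> that is orthogonal to every \<open>A j\<close> is orthogonal to itself, hence
  zero, and by independence its coefficients vanish. So the real square matrix \<open>g\<close> is injective,
  hence onto. The coefficients found are those of the projection on the real span of the \<open>A i\<close> of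
  any matrix whose products with the \<open>A j\<close> are the numbers \<open>b j\<close>.\<close>

lemma normal_equations_solvable:
  fixes A :: "'m::finite \<Rightarrow> 'h::real_or_complex ^ 'n ^ 'n"
  assumes indep: "\<not> dependent_family A"
    and real: "\<And>i j. frobenius (A i) (A j) = of_real (g i j)"
  obtains c :: "'m \<Rightarrow> real" where "\<And>j. (\<Sum>i\<in>UNIV. c i * g i j) = b j"
proof -
  define h where "h x = (\<chi> j. \<Sum>i\<in>UNIV. x $ i * g i j)" for x :: "real ^ 'm"
  have lin: "linear h"
    by (rule linearI)
      (simp_all add: h_def vec_eq_iff distrib_right sum.distrib sum_distrib_left mult.assoc)
  have "x = 0" if "h x = 0" for x
  proof -
    define S where "S = (\<Sum>i\<in>UNIV. (x $ i) *\<^sub>R A i)"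
    have "frobenius S (A j) = of_real (h x $ j)" for j
      unfolding S_def h_def frobenius_sum_left real by (simp add: scaleR_conv_of_real)
    then have "frobenius S (\<Sum>i\<in>UNIV. (x $ i) *\<^sub>R A i) = 0"
      using that by (simp add: frobenius_sum_right)
    then have "S = 0" by (simp flip: S_def add: frobenius_self_eq_0_iff)
    then show "x = 0"
      using indep by (auto simp: dependent_family_def S_def vec_eq_iff)
  qed
  then have "inj h" by (simp add: linear_injective_0[OF lin])
  then have "surj h" using lin by (simp add: linear_injective_imp_surjective)
  then obtain x where "h x = (\<chi> j. b j)" by (metis surjD)
  then show thesis
    by (intro that[of "\<lambda>i. x $ i"]) (simp add: h_def vec_eq_iff)
qed

lemma dependent_case_option_iff:
  fixes A :: "'m::finite \<Rightarrow> 'v::real_vector"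
  assumes "\<not> dependent_family A"
  shows "dependent_family (case_option B A) \<longleftrightarrow> (\<exists>a. B = (\<Sum>i\<in>UNIV. a i *\<^sub>R A i))"
proof
  assume "dependent_family (case_option B A)"
  then obtain d i where d: "d i \<noteq> 0"
      and eq: "d None *\<^sub>R B + (\<Sum>i\<in>UNIV. d (Some i) *\<^sub>R A i) = 0"
    by (auto simp: dependent_family_def UNIV_option_conv sum.reindex)
  have "d None \<noteq> 0"
  proof
    assume "d None = 0"
    with d eq have "d (Some (the i)) \<noteq> 0" "(\<Sum>i\<in>UNIV. d (Some i) *\<^sub>R A i) = 0"
      by (cases i, auto)+
    with assms show False by (auto simp: dependent_family_def)
  qed
  from eq have "d None *\<^sub>R B = - (\<Sum>i\<in>UNIV. d (Some i) *\<^sub>R A i)"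
    by (simp add: eq_neg_iff_add_eq_0)
  then have "(1 / d None) *\<^sub>R (d None *\<^sub>R B)
      = (\<Sum>i\<in>UNIV. (- d (Some i) / d None) *\<^sub>R A i)"
    by (simp add: scaleR_sum_right sum_negf)
  with \<open>d None \<noteq> 0\<close> show "\<exists>a. B = (\<Sum>i\<in>UNIV. a i *\<^sub>R A i)"
    by (intro exI[of _ "\<lambda>i. - d (Some i) / d None"]) simp
next
  assume "\<exists>a. B = (\<Sum>i\<in>UNIV. a i *\<^sub>R A i)"
  then obtain a where "B = (\<Sum>i\<in>UNIV. a i *\<^sub>R A i)" ..
  then show "dependent_family (case_option B A)"
    unfolding dependent_family_def
    by (intro exI[of _ "case_option (- 1) a"])
      (auto simp: UNIV_option_conv sum.reindex intro: exI[of _ None])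
qed

text \<open>For a solution \<open>c\<close> of the normal equations the residual
  \<open>R = B - (\<Sum>i. c i *\<^sub>R A i)\<close> is orthogonal to the span of the \<open>A i\<close>, so its squared norm is its
  product with \<open>B\<close>, which is \<open>s - (\<Sum>i. c i * b i)\<close>. If \<open>B\<close> lies in the span then so does \<open>R\<close>,
  and \<open>R\<close> is orthogonal to itself.\<close>

lemma dependent_extension_iff:
  fixes A :: "'m::finite \<Rightarrow> 'h::real_or_complex ^ 'n ^ 'n"
  assumes indep: "\<not> dependent_family A"
    and g: "\<And>i j. frobenius (A i) (A j) = of_real (g i j)"
    and b: "\<And>i. frobenius B (A i) = of_real (b i)"
    and s: "frobenius B B = of_real s"
    and c: "\<And>j. (\<Sum>i\<in>UNIV. c i * g i j) = b j"
  shows "dependent_family (case_option B A) \<longleftrightarrow> (\<Sum>i\<in>UNIV. c i * b i) = s"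
proof -
  define R where "R = B - (\<Sum>i\<in>UNIV. c i *\<^sub>R A i)"
  have "frobenius R (A j) = of_real (b j - (\<Sum>i\<in>UNIV. c i * g i j))" for j
    unfolding R_def frobenius_diff_left frobenius_sum_left b g
    by (simp add: scaleR_conv_of_real)
  then have orth: "frobenius R (\<Sum>i\<in>UNIV. a i *\<^sub>R A i) = 0" for a
    by (simp add: frobenius_sum_right c)
  have "frobenius (A i) B = of_real (b i)" for i
    by (metis b conjugate_frobenius conjugate_of_real)
  then have "frobenius R B = of_real (s - (\<Sum>i\<in>UNIV. c i * b i))"
    unfolding R_def frobenius_diff_left frobenius_sum_left s
    by (simp add: scaleR_conv_of_real)
  moreover have RR: "frobenius R R = frobenius R B"
    by (subst (2) R_def) (simp add: frobenius_diff_right orth)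
  ultimately have R0: "R = 0 \<longleftrightarrow> (\<Sum>i\<in>UNIV. c i * b i) = s"
    by (metis frobenius_self_eq_0_iff of_real_eq_0_iff right_minus_eq)
  have "(\<exists>a. B = (\<Sum>i\<in>UNIV. a i *\<^sub>R A i)) \<longleftrightarrow> R = 0"
  proof
    assume "\<exists>a. B = (\<Sum>i\<in>UNIV. a i *\<^sub>R A i)"
    then have "frobenius R R = 0" using orth RR by auto
    then show "R = 0" by (simp add: frobenius_self_eq_0_iff)
  qed (auto simp: R_def)
  then show ?thesis using R0 dependent_case_option_iff[OF indep] by simp
qed

section \<open>The quadratic form of the inverse in an eigenbasis\<close>

text \<open>For invertible \<open>A\<close> the left-hand side is the quadratic form of the inverse of \<open>A\<close> at the
  vector \<open>A *v x\<close>, whose coordinates are the \<open>y i\<close>. With \<open>z i = hinner x (e i)\<close>, self-adjointness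
  gives \<open>y i = \<mu> i * z i\<close>, so both sides equal \<open>\<Sum>i. \<mu> i * \<bar>z i\<bar>\<^sup>2\<close>. A zero eigenvalue forces \<open>y i = 0\<close> and contributes 0 on both sides,
  because division by zero yields zero.\<close>

lemma quadratic_form_in_eigenbasis:
  fixes A :: "'h::real_or_complex ^ 'm ^ 'm" and e :: "'k::finite \<Rightarrow> 'h ^ 'm"
  assumes selfadj: "conj_transpose A = A"
    and orthonormal: "\<And>i j. hinner (e i) (e j) = (if i = j then 1 else 0)"
    and eigen: "\<And>i. A *v e i = of_real (\<mu> i) *s e i"
    and y: "(\<Sum>i\<in>UNIV. y i *s e i) = A *v x"
  shows "hinner (A *v x) x = of_real (\<Sum>i\<in>UNIV. (norm (y i))\<^sup>2 / \<mu> i)"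
proof -
  have yz: "y i = of_real (\<mu> i) * hinner x (e i)" for i
  proof -
    have "hinner (A *v x) (e i) = y i"
      by (simp flip: y add: hinner_sum_left orthonormal if_distrib cong: if_cong)
    then show ?thesis
      by (simp add: hinner_adjoint[OF selfadj] eigen hinner_scale_right)
  qed
  have "hinner (A *v x) x = (\<Sum>i\<in>UNIV. y i * conjugate (hinner x (e i)))"
    by (simp flip: y add: hinner_sum_left conjugate_hinner)
  also have "\<dots> = (\<Sum>i\<in>UNIV. of_real (\<mu> i * (norm (hinner x (e i)))\<^sup>2))"
    by (simp add: yz mult.assoc mult_conjugate_of_real)
  finally have expansion:
    "hinner (A *v x) x = (\<Sum>i\<in>UNIV. of_real (\<mu> i * (norm (hinner x (e i)))\<^sup>2))" .
  have "\<mu> i * (norm (hinner x (e i)))\<^sup>2 = (norm (y i))\<^sup>2 / \<mu> i" for i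
  proof -
    have "(norm (y i))\<^sup>2 = (\<mu> i)\<^sup>2 * (norm (hinner x (e i)))\<^sup>2"
      by (simp add: yz norm_mult power_mult_distrib)
    then show ?thesis by (cases "\<mu> i = 0") (simp_all add: power2_eq_square)
  qed
  then show ?thesis unfolding expansion by (simp only: of_real_sum)
qed

section \<open>The criterion for rank-one matrices\<close>

theorem proposition9p2:
  fixes \<phi> :: "'m::finite \<Rightarrow> 'h::real_or_complex ^ 'n::finite"
    and \<phi>_new :: "'h ^ 'n"
    and e :: "'m \<Rightarrow> 'h ^ 'm"
    and \<mu> :: "'m \<Rightarrow> real"
    and f :: "('m \<Rightarrow> 'h) \<Rightarrow> real"
    and y :: "'m \<Rightarrow> 'h"
  assumes unit: "\<And>i. norm (\<phi> i) = 1"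
    and unit_new: "norm \<phi>_new = 1"
    and indep: "\<not> dependent_family (\<lambda>i. outer (\<phi> i))"
    and dim: "CARD('m) + 1 \<le> dim (sym_mats :: ('h ^ 'n ^ 'n) set)"
    and orthonormal: "\<And>i j. hinner (e i) (e j) = (if i = j then 1 else 0)"
    and eigen: "\<And>i. gram_op \<phi> *v e i = of_real (\<mu> i) *s e i"
    and f: "\<And>x. f x = (\<Sum>i\<in>UNIV. (norm (x i))\<^sup>2 / \<mu> i)"
    and y: "(\<Sum>i\<in>UNIV. y i *s e i) =
              hadamard (analysis_op \<phi> \<phi>_new) (conj_vec (analysis_op \<phi> \<phi>_new))"
  shows "f y = 1 \<longleftrightarrow>
    dependent_family (case_option (outer \<phi>_new) (\<lambda>i. outer (\<phi> i)))"
proof -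
  define g where "g i j = (norm (hinner (\<phi> i) (\<phi> j)))\<^sup>2" for i j
  define b where "b i = (norm (hinner \<phi>_new (\<phi> i)))\<^sup>2" for i
  obtain c where c: "\<And>j. (\<Sum>i\<in>UNIV. c i * g i j) = b j"
    using normal_equations_solvable[OF indep, of g b] by (auto simp: frobenius_outer g_def)
  define x :: "'h ^ 'm" where "x = (\<chi> i. of_real (c i))"
  have g_sym: "g i j = g j i" for i j
  proof -
    have "of_real (g i j) = (of_real (g j i) :: 'h)"
      unfolding g_def by (metis frobenius_outer conjugate_frobenius conjugate_of_real)
    then show ?thesis by (simp only: of_real_eq_iff)
  qed
  have G: "gram_op \<phi> = (\<chi> i j. of_real (g i j))"
    by (simp add: gram_op_def frobenius_outer g_def)
  have selfadj: "conj_transpose (gram_op \<phi>) = gram_op \<phi>"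
    by (simp add: G conj_transpose_def g_sym vec_eq_iff)
  have Gx: "gram_op \<phi> *v x = (\<chi> i. of_real (b i))"
  proof -
    have "(\<Sum>j\<in>UNIV. of_real (g i j) * of_real (c j)) = (of_real (b i) :: 'h)" for i
      by (simp flip: c of_real_mult of_real_sum add: g_sym[of i] mult.commute)
    then show ?thesis by (simp add: G matrix_vector_mult_def x_def vec_eq_iff)
  qed
  have "(\<Sum>i\<in>UNIV. y i *s e i) = gram_op \<phi> *v x"
    unfolding y Gx
    by (simp add: hadamard_def conj_vec_def analysis_op_def b_def mult_conjugate_of_real)
  then have "hinner (gram_op \<phi> *v x) x = of_real (f y)"
    unfolding f by (rule quadratic_form_in_eigenbasis[OF selfadj orthonormal eigen])
  moreover have "hinner (gram_op \<phi> *v x) x = of_real (\<Sum>i\<in>UNIV. c i * b i)"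
    unfolding Gx by (simp add: hinner_def x_def mult.commute)
  ultimately have "f y = (\<Sum>i\<in>UNIV. c i * b i)"
    by (metis of_real_eq_iff)
  moreover have "dependent_family (case_option (outer \<phi>_new) (\<lambda>i. outer (\<phi> i)))
      \<longleftrightarrow> (\<Sum>i\<in>UNIV. c i * b i) = 1"
    by (rule dependent_extension_iff[OF indep _ _ _ c])
      (simp_all add: frobenius_outer g_def b_def hinner_self unit_new)
  ultimately show ?thesis by simp
qed

end
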